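(* Let $(Z_1,Z_0,\varphi)$, $(V_1,V_0,d)$ and $(E_1,E_0,\varphi_E)$ be Zinbiel 2-algebras. Then $(E_1,E_0,\varphi_E)$ factorizes through $(Z_1,Z_0,\varphi)$ and $(V_1,V_0,d)$ if and only if there exists a matched pair of Zinbiel 2-algebras $(Z_1,Z_0,\varphi)$ and $(V_1,V_0,d)$ such that $(E_1,E_0,\varphi_E)\cong Z\bowtie V$.
   Context: All vector spaces are over an algebraically closed field $k$ of characteristic different from 2 and 3. A Zinbiel algebra is a vector space $Z$ with a bilinear multiplication $\cdot$ satisfying $(x\cdot y)\cdot z=x\cdot(y\cdot z+z\cdot y)$. A bimodule of a Zinbiel algebra $Z$ is a vector space $V$ with bilinear maps $\triangleright:Z\times V\to V$, $\triangleleft:V\times Z\to V$ such that $(x\cdot y)\triangleright v=x\triangleright(y\triangleright v+v\triangleleft y)$, $(v\triangleleft x)\triangleleft y=v\triangleleft(x\cdot y+y\cdot x)$, $(x\triangleright v)\triangleleft y=x\triangleright(v\triangleleft y+y\triangleright v)$. A Zinbiel algebra $Z_0$ acts on a Zinbiel algebra $Z_1$ if there are bilinear maps $\triangleright:Z_0\times Z_1\to Z_1$, $\triangleleft:Z_1\times Z_0\to Z_1$ making $Z_1$ a $Z_0$-bimodule and such that $(x_0\triangleright x_1)\cdot y_1=x_0\triangleright(x_1\cdot y_1+y_1\cdot x_1)$, $(x_1\triangleleft x_0)\cdot y_1=x_1\cdot(x_0\triangleright y_1+y_1\triangleleft x_0)$, $(x_1\cdot y_1)\triangleleft x_0=x_1\cdot(y_1\triangleleft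 x_0+x_0\triangleright y_1)$. A (strict) Zinbiel 2-algebra (= crossed module of Zinbiel algebras) $(Z_1,Z_0,\varphi)$ is a homomorphism of Zinbiel algebras $\varphi:Z_1\to Z_0$ with an action of $Z_0$ on $Z_1$ such that $\varphi(x_0\triangleright x_1)=x_0\cdot\varphi(x_1)$, $\varphi(x_1\triangleleft x_0)=\varphi(x_1)\cdot x_0$, $\varphi(x_1)\triangleright y_1=x_1\cdot y_1=x_1\triangleleft\varphi(y_1)$. In $(Z_1,Z_0,\varphi)$ the actions are also written $x_0\cdot x_1:=x_0\triangleright x_1$, $x_1\cdot x_0:=x_1\triangleleft x_0$. In $(V_1,V_0,d)$ the multiplication of $V_i$ is written $\ast_i$ ($i=0,1$) and the actions are written $u_0\ast_2 u_1:=u_0\triangleright u_1$, $u_1\ast_3 u_0:=u_1\triangleleft u_0$. An isomorphism $(Z_1,Z_0,\varphi)\to(Z_1',Z_0',\varphi')$ is a pair $\phi=(\phi_1,\phi_0)$ of bijective Zinbiel algebra homomorphisms $\phi_i:Z_i\to Z_i'$ with $\varphi'\circ\phi_1=\phi_0\circ\varphi$ that preserves the actions: $\phi_1(x_0\triangleright x_1)=\phi_0(x_0)\triangleright\phi_1(x_1)$, $\phi_1(x_1\triangleleft x_0)=\phi_1(x_1)\triangleleft\phi_0(x_0)$. $(Z_1',Z_0',\varphi')$ is a subalgebra of $(Z_1,Z_0,\varphi)$ if $Z_i'$ is a subalgebra of $Z_i$, $\varphi|_{Z_1'}=\varphi'$, and the actions are the restricted ones. $(E_1,E_0,\varphi_E)$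 factorizes through $(Z_1,Z_0,\varphi)$ and $(V_1,V_0,d)$ if it contains (isomorphic copies of) $(Z_1,Z_0,\varphi)$ and $(V_1,V_0,d)$ as subalgebras such that $E=Z\oplus V$ as 2-vector spaces, i.e. $E_i=Z_i\oplus V_i$ for $i=0,1$ and $\varphi_E=\varphi\oplus d$. Zinbiel 2-algebras $(Z_1,Z_0,\varphi)$ and $(V_1,V_0,d)$ form a matched pair if there are bilinear maps, for $j=0,1,2,3$, $\rightharpoonup_j:V_a\times Z_b\to Z_c$, $\leftharpoonup_j:Z_a\times V_b\to Z_c$, $\triangleright_j:Z_a\times V_b\to V_c$, $\triangleleft_j:V_a\times Z_b\to V_c$, where $(a,b,c)=(0,0,0),(1,1,1),(0,1,1),(1,0,1)$ for $j=0,1,2,3$ respectively, such that $Z\oplus V$, with underlying spaces $Z_i\oplus V_i$ and structure map $(x,u)\mapsto(\varphi(x),d(u))$, is a Zinbiel 2-algebra under $(x_i,u_i)\circ_i(y_i,v_i)=(x_i\cdot y_i+x_i\leftharpoonup_i v_i+u_i\rightharpoonup_i y_i,\ x_i\triangleright_i v_i+u_i\triangleleft_i y_i+u_i\ast_i v_i)$, $i=0,1$; $(x_0,u_0)\triangleright(x_1,u_1)=(x_0\cdot x_1+x_0\leftharpoonup_2 u_1+u_0\rightharpoonup_2 x_1,\ x_0\triangleright_2 u_1+u_0\triangleleft_2 x_1+u_0\ast_2 u_1)$; $(x_1,u_1)\triangleleft(x_0,u_0)=(x_1\cdot x_0+x_1\leftharpoonup_3 u_0+u_1\rightharpoonup_3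 x_0,\ x_1\triangleright_3 u_0+u_1\triangleleft_3 x_0+u_1\ast_3 u_0)$. This Zinbiel 2-algebra is called the bicrossed product $Z\bowtie V$. *)

theory Defs
  imports
    "HOL-Computational_Algebra.Computational_Algebra"
    "HOL-Library.Product_Plus"
    "HOL-Library.FuncSet"
begin

text \<open>
  A vector space is a linear subspace \<open>carr\<close> of an ambient vector space given by a type of
  class \<^class>\<open>ab_group_add\<close> with a scalar multiplication.  Working with carriers, rather than with
  whole types, lets subalgebras and direct sum decompositions be stated literally.  Products, actions
  and structure maps are only meaningful on the carriers.
\<close>

record ('k, 'a) vspace =
  carr :: "'a set"
  smult :: "'k \<Rightarrow> 'a \<Rightarrow> 'a"

definition vector_space_on :: "('k::field, 'a::ab_group_add, 'm) vspace_scheme \<Rightarrow> bool" where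
  "vector_space_on V \<longleftrightarrow> vector_space (smult V) \<and> module.subspace (smult V) (carr V)"

definition linear_map ::
  "('k::field, 'a::ab_group_add, 'm) vspace_scheme \<Rightarrow> ('k, 'b::ab_group_add, 'n) vspace_scheme
    \<Rightarrow> ('a \<Rightarrow> 'b) \<Rightarrow> bool" where
  "linear_map V W f \<longleftrightarrow>
     f \<in> carr V \<rightarrow> carr W \<and>
     (\<forall>x\<in>carr V. \<forall>y\<in>carr V. f (x + y) = f x + f y) \<and>
     (\<forall>c. \<forall>x\<in>carr V. f (smult V c x) = smult W c (f x))"

definition bilinear_map ::
  "('k::field, 'a::ab_group_add, 'm) vspace_scheme \<Rightarrow> ('k, 'b::ab_group_add, 'n) vspace_scheme
    \<Rightarrow> ('k, 'c::ab_group_add, 'p) vspace_scheme \<Rightarrow> ('a \<Rightarrow> 'b \<Rightarrow> 'c) \<Rightarrow> bool" where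
  "bilinear_map U V W f \<longleftrightarrow>
     (\<forall>x\<in>carr U. linear_map V W (\<lambda>y. f x y)) \<and>
     (\<forall>y\<in>carr V. linear_map U W (\<lambda>x. f x y))"

definition direct_sum ::
  "('k::field, 'a::ab_group_add, 'm) vspace_scheme \<Rightarrow> ('k, 'a, 'n) vspace_scheme
    \<Rightarrow> ('k, 'a, 'p) vspace_scheme \<Rightarrow> bool" where
  "direct_sum E A B \<longleftrightarrow>
     carr E = {x + u |x u. x \<in> carr A \<and> u \<in> carr B} \<and> carr A \<inter> carr B = {0}"

record ('k, 'a) zinbiel = "('k, 'a) vspace" +
  mul :: "'a \<Rightarrow> 'a \<Rightarrow> 'a"  (infixl \<open>\<cdot>\<index>\<close> 70)

definition zinbiel_algebra :: "('k::field, 'a::ab_group_add) zinbiel \<Rightarrow> bool" where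
  "zinbiel_algebra Z \<longleftrightarrow>
     vector_space_on Z \<and> bilinear_map Z Z Z (mul Z) \<and>
     (\<forall>x\<in>carr Z. \<forall>y\<in>carr Z. \<forall>z\<in>carr Z.
        (x \<cdot>\<^bsub>Z\<^esub> y) \<cdot>\<^bsub>Z\<^esub> z = x \<cdot>\<^bsub>Z\<^esub> (y \<cdot>\<^bsub>Z\<^esub> z + z \<cdot>\<^bsub>Z\<^esub> y))"

definition zinbiel_hom ::
  "('k::field, 'a::ab_group_add) zinbiel \<Rightarrow> ('k, 'b::ab_group_add) zinbiel \<Rightarrow> ('a \<Rightarrow> 'b) \<Rightarrow> bool" where
  "zinbiel_hom Z W f \<longleftrightarrow>
     linear_map Z W f \<and> (\<forall>x\<in>carr Z. \<forall>y\<in>carr Z. f (x \<cdot>\<^bsub>Z\<^esub> y) = f x \<cdot>\<^bsub>W\<^esub> f y)"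

definition zinbiel_subalgebra ::
  "('k::field, 'a::ab_group_add) zinbiel \<Rightarrow> ('k, 'a) zinbiel \<Rightarrow> bool" where
  "zinbiel_subalgebra A Z \<longleftrightarrow>
     zinbiel_algebra A \<and> zinbiel_algebra Z \<and> carr A \<subseteq> carr Z \<and>
     (\<forall>c. \<forall>x\<in>carr A. smult A c x = smult Z c x) \<and>
     (\<forall>x\<in>carr A. \<forall>y\<in>carr A. x \<cdot>\<^bsub>A\<^esub> y = x \<cdot>\<^bsub>Z\<^esub> y)"

definition zinbiel_bimodule ::
  "('k::field, 'a::ab_group_add) zinbiel \<Rightarrow> ('k, 'b::ab_group_add, 'm) vspace_scheme
    \<Rightarrow> ('a \<Rightarrow> 'b \<Rightarrow> 'b) \<Rightarrow> ('b \<Rightarrow> 'a \<Rightarrow> 'b) \<Rightarrow> bool" where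
  "zinbiel_bimodule Z V l r \<longleftrightarrow>
     zinbiel_algebra Z \<and> vector_space_on V \<and> bilinear_map Z V V l \<and> bilinear_map V Z V r \<and>
     (\<forall>x\<in>carr Z. \<forall>y\<in>carr Z. \<forall>v\<in>carr V.
        l (x \<cdot>\<^bsub>Z\<^esub> y) v = l x (l y v + r v y) \<and>
        r (r v x) y = r v (x \<cdot>\<^bsub>Z\<^esub> y + y \<cdot>\<^bsub>Z\<^esub> x) \<and>
        r (l x v) y = l x (r v y + l y v))"

definition zinbiel_action ::
  "('k::field, 'a::ab_group_add) zinbiel \<Rightarrow> ('k, 'b::ab_group_add) zinbiel
    \<Rightarrow> ('a \<Rightarrow> 'b \<Rightarrow> 'b) \<Rightarrow> ('b \<Rightarrow> 'a \<Rightarrow> 'b) \<Rightarrow> bool" where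
  "zinbiel_action Z0 Z1 l r \<longleftrightarrow>
     zinbiel_algebra Z0 \<and> zinbiel_algebra Z1 \<and> zinbiel_bimodule Z0 Z1 l r \<and>
     (\<forall>x0\<in>carr Z0. \<forall>x1\<in>carr Z1. \<forall>y1\<in>carr Z1.
        l x0 x1 \<cdot>\<^bsub>Z1\<^esub> y1 = l x0 (x1 \<cdot>\<^bsub>Z1\<^esub> y1 + y1 \<cdot>\<^bsub>Z1\<^esub> x1) \<and>
        r x1 x0 \<cdot>\<^bsub>Z1\<^esub> y1 = x1 \<cdot>\<^bsub>Z1\<^esub> (l x0 y1 + r y1 x0) \<and>
        r (x1 \<cdot>\<^bsub>Z1\<^esub> y1) x0 = x1 \<cdot>\<^bsub>Z1\<^esub> (r y1 x0 + l x0 y1))"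

record ('k, 'a1, 'a0) zinbiel2 =
  alg1 :: "('k, 'a1) zinbiel"
  alg0 :: "('k, 'a0) zinbiel"
  smap :: "'a1 \<Rightarrow> 'a0"
  lact :: "'a0 \<Rightarrow> 'a1 \<Rightarrow> 'a1"
  ract :: "'a1 \<Rightarrow> 'a0 \<Rightarrow> 'a1"

definition zinbiel_2_algebra ::
  "('k::field, 'a1::ab_group_add, 'a0::ab_group_add) zinbiel2 \<Rightarrow> bool" where
  "zinbiel_2_algebra Z \<longleftrightarrow>
     zinbiel_algebra (alg1 Z) \<and> zinbiel_algebra (alg0 Z) \<and>
     zinbiel_hom (alg1 Z) (alg0 Z) (smap Z) \<and>
     zinbiel_action (alg0 Z) (alg1 Z) (lact Z) (ract Z) \<and>
     (\<forall>x0\<in>carr (alg0 Z). \<forall>x1\<in>carr (alg1 Z).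
        smap Z (lact Z x0 x1) = x0 \<cdot>\<^bsub>alg0 Z\<^esub> smap Z x1 \<and>
        smap Z (ract Z x1 x0) = smap Z x1 \<cdot>\<^bsub>alg0 Z\<^esub> x0) \<and>
     (\<forall>x1\<in>carr (alg1 Z). \<forall>y1\<in>carr (alg1 Z).
        lact Z (smap Z x1) y1 = x1 \<cdot>\<^bsub>alg1 Z\<^esub> y1 \<and>
        x1 \<cdot>\<^bsub>alg1 Z\<^esub> y1 = ract Z x1 (smap Z y1))"

definition zinbiel2_iso ::
  "('k::field, 'a1::ab_group_add, 'a0::ab_group_add) zinbiel2
    \<Rightarrow> ('k, 'b1::ab_group_add, 'b0::ab_group_add) zinbiel2
    \<Rightarrow> ('a1 \<Rightarrow> 'b1) \<Rightarrow> ('a0 \<Rightarrow> 'b0) \<Rightarrow> bool" where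
  "zinbiel2_iso Z W f1 f0 \<longleftrightarrow>
     zinbiel_hom (alg1 Z) (alg1 W) f1 \<and> bij_betw f1 (carr (alg1 Z)) (carr (alg1 W)) \<and>
     zinbiel_hom (alg0 Z) (alg0 W) f0 \<and> bij_betw f0 (carr (alg0 Z)) (carr (alg0 W)) \<and>
     (\<forall>x1\<in>carr (alg1 Z). smap W (f1 x1) = f0 (smap Z x1)) \<and>
     (\<forall>x0\<in>carr (alg0 Z). \<forall>x1\<in>carr (alg1 Z).
        f1 (lact Z x0 x1) = lact W (f0 x0) (f1 x1) \<and>
        f1 (ract Z x1 x0) = ract W (f1 x1) (f0 x0))"

definition zinbiel2_isomorphic ::
  "('k::field, 'a1::ab_group_add, 'a0::ab_group_add) zinbiel2
    \<Rightarrow> ('k, 'b1::ab_group_add, 'b0::ab_group_add) zinbiel2 \<Rightarrow> bool"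
  (infix \<open>\<cong>\<^sub>Z\<close> 50) where
  "Z \<cong>\<^sub>Z W \<longleftrightarrow> (\<exists>f1 f0. zinbiel2_iso Z W f1 f0)"

definition zinbiel2_subalgebra ::
  "('k::field, 'a1::ab_group_add, 'a0::ab_group_add) zinbiel2 \<Rightarrow> ('k, 'a1, 'a0) zinbiel2 \<Rightarrow> bool" where
  "zinbiel2_subalgebra A Z \<longleftrightarrow>
     zinbiel_2_algebra A \<and> zinbiel_2_algebra Z \<and>
     zinbiel_subalgebra (alg1 A) (alg1 Z) \<and> zinbiel_subalgebra (alg0 A) (alg0 Z) \<and>
     (\<forall>x1\<in>carr (alg1 A). smap Z x1 = smap A x1) \<and>
     (\<forall>x0\<in>carr (alg0 A). \<forall>x1\<in>carr (alg1 A).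
        lact A x0 x1 = lact Z x0 x1 \<and> ract A x1 x0 = ract Z x1 x0)"

definition factorizes_through ::
  "('k::field, 'e1::ab_group_add, 'e0::ab_group_add) zinbiel2
    \<Rightarrow> ('k, 'z1::ab_group_add, 'z0::ab_group_add) zinbiel2
    \<Rightarrow> ('k, 'v1::ab_group_add, 'v0::ab_group_add) zinbiel2 \<Rightarrow> bool" where
  "factorizes_through E Z V \<longleftrightarrow>
     (\<exists>Z' V'. zinbiel2_subalgebra Z' E \<and> zinbiel2_subalgebra V' E \<and>
        Z \<cong>\<^sub>Z Z' \<and> V \<cong>\<^sub>Z V' \<and>
        direct_sum (alg1 E) (alg1 Z') (alg1 V') \<and>
        direct_sum (alg0 E) (alg0 Z') (alg0 V') \<and>
        (\<forall>x\<in>carr (alg1 Z'). \<forall>u\<in>carr (alg1 V'). smap E (x + u) = smap Z' x + smap V' u))"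

text \<open>
  The field \<open>rhj\<close> (right harpoon) is $\rightharpoonup_j$, \<open>lhj\<close> (left harpoon) is
  $\leftharpoonup_j$, \<open>rtj\<close> (right triangle) is $\triangleright_j$ and \<open>ltj\<close> (left triangle) is
  $\triangleleft_j$.
\<close>

record ('z1, 'z0, 'v1, 'v0) pair_maps =
  rh0 :: "'v0 \<Rightarrow> 'z0 \<Rightarrow> 'z0"
  rh1 :: "'v1 \<Rightarrow> 'z1 \<Rightarrow> 'z1"
  rh2 :: "'v0 \<Rightarrow> 'z1 \<Rightarrow> 'z1"
  rh3 :: "'v1 \<Rightarrow> 'z0 \<Rightarrow> 'z1"
  lh0 :: "'z0 \<Rightarrow> 'v0 \<Rightarrow> 'z0"
  lh1 :: "'z1 \<Rightarrow> 'v1 \<Rightarrow> 'z1"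
  lh2 :: "'z0 \<Rightarrow> 'v1 \<Rightarrow> 'z1"
  lh3 :: "'z1 \<Rightarrow> 'v0 \<Rightarrow> 'z1"
  rt0 :: "'z0 \<Rightarrow> 'v0 \<Rightarrow> 'v0"
  rt1 :: "'z1 \<Rightarrow> 'v1 \<Rightarrow> 'v1"
  rt2 :: "'z0 \<Rightarrow> 'v1 \<Rightarrow> 'v1"
  rt3 :: "'z1 \<Rightarrow> 'v0 \<Rightarrow> 'v1"
  lt0 :: "'v0 \<Rightarrow> 'z0 \<Rightarrow> 'v0"
  lt1 :: "'v1 \<Rightarrow> 'z1 \<Rightarrow> 'v1"
  lt2 :: "'v0 \<Rightarrow> 'z1 \<Rightarrow> 'v1"
  lt3 :: "'v1 \<Rightarrow> 'z0 \<Rightarrow> 'v1"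

definition pair_maps_bilinear ::
  "('k::field, 'z1::ab_group_add, 'z0::ab_group_add) zinbiel2
    \<Rightarrow> ('k, 'v1::ab_group_add, 'v0::ab_group_add) zinbiel2
    \<Rightarrow> ('z1, 'z0, 'v1, 'v0) pair_maps \<Rightarrow> bool" where
  "pair_maps_bilinear Z V M \<longleftrightarrow>
     bilinear_map (alg0 V) (alg0 Z) (alg0 Z) (rh0 M) \<and>
     bilinear_map (alg1 V) (alg1 Z) (alg1 Z) (rh1 M) \<and>
     bilinear_map (alg0 V) (alg1 Z) (alg1 Z) (rh2 M) \<and>
     bilinear_map (alg1 V) (alg0 Z) (alg1 Z) (rh3 M) \<and>
     bilinear_map (alg0 Z) (alg0 V) (alg0 Z) (lh0 M) \<and>
     bilinear_map (alg1 Z) (alg1 V) (alg1 Z) (lh1 M) \<and>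
     bilinear_map (alg0 Z) (alg1 V) (alg1 Z) (lh2 M) \<and>
     bilinear_map (alg1 Z) (alg0 V) (alg1 Z) (lh3 M) \<and>
     bilinear_map (alg0 Z) (alg0 V) (alg0 V) (rt0 M) \<and>
     bilinear_map (alg1 Z) (alg1 V) (alg1 V) (rt1 M) \<and>
     bilinear_map (alg0 Z) (alg1 V) (alg1 V) (rt2 M) \<and>
     bilinear_map (alg1 Z) (alg0 V) (alg1 V) (rt3 M) \<and>
     bilinear_map (alg0 V) (alg0 Z) (alg0 V) (lt0 M) \<and>
     bilinear_map (alg1 V) (alg1 Z) (alg1 V) (lt1 M) \<and>
     bilinear_map (alg0 V) (alg1 Z) (alg1 V) (lt2 M) \<and>
     bilinear_map (alg1 V) (alg0 Z) (alg1 V) (lt3 M)"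

definition bicrossed_product ::
  "('k::field, 'z1::ab_group_add, 'z0::ab_group_add) zinbiel2
    \<Rightarrow> ('k, 'v1::ab_group_add, 'v0::ab_group_add) zinbiel2
    \<Rightarrow> ('z1, 'z0, 'v1, 'v0) pair_maps
    \<Rightarrow> ('k, 'z1 \<times> 'v1, 'z0 \<times> 'v0) zinbiel2" where
  "bicrossed_product Z V M =
     \<lparr> alg1 =
         \<lparr> carr = carr (alg1 Z) \<times> carr (alg1 V),
           smult = (\<lambda>c (x, u). (smult (alg1 Z) c x, smult (alg1 V) c u)),
           mul = (\<lambda>(x, u) (y, v).
             (x \<cdot>\<^bsub>alg1 Z\<^esub> y + lh1 M x v + rh1 M u y,
              rt1 M x v + lt1 M u y + u \<cdot>\<^bsub>alg1 V\<^esub> v)) \<rparr>,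
       alg0 =
         \<lparr> carr = carr (alg0 Z) \<times> carr (alg0 V),
           smult = (\<lambda>c (x, u). (smult (alg0 Z) c x, smult (alg0 V) c u)),
           mul = (\<lambda>(x, u) (y, v).
             (x \<cdot>\<^bsub>alg0 Z\<^esub> y + lh0 M x v + rh0 M u y,
              rt0 M x v + lt0 M u y + u \<cdot>\<^bsub>alg0 V\<^esub> v)) \<rparr>,
       smap = (\<lambda>(x, u). (smap Z x, smap V u)),
       lact = (\<lambda>(x0, u0) (x1, u1).
         (lact Z x0 x1 + lh2 M x0 u1 + rh2 M u0 x1,
          rt2 M x0 u1 + lt2 M u0 x1 + lact V u0 u1)),
       ract = (\<lambda>(x1, u1) (x0, u0).
         (ract Z x1 x0 + lh3 M x1 u0 + rh3 M u1 x0,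
          rt3 M x1 u0 + lt3 M u1 x0 + ract V u1 u0)) \<rparr>"

definition matched_pair ::
  "('k::field, 'z1::ab_group_add, 'z0::ab_group_add) zinbiel2
    \<Rightarrow> ('k, 'v1::ab_group_add, 'v0::ab_group_add) zinbiel2
    \<Rightarrow> ('z1, 'z0, 'v1, 'v0) pair_maps \<Rightarrow> bool" where
  "matched_pair Z V M \<longleftrightarrow>
     zinbiel_2_algebra Z \<and> zinbiel_2_algebra V \<and> pair_maps_bilinear Z V M \<and>
     zinbiel_2_algebra (bicrossed_product Z V M)"

end

theory Submission
  imports Defs
begin

text \<open>
  Let \<open>f : Z \<rightarrow> E\<close> and \<open>g : V \<rightarrow> E\<close> be embeddings onto complementary subalgebras.  Then
  \<open>(x, u) \<mapsto> f x + g u\<close> is a linear bijection from \<open>Z \<times> V\<close> to \<open>E\<close>, and the components of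
  its inverse, applied to the mixed products \<open>f x \<cdot> g u\<close> and \<open>g u \<cdot> f x\<close>, give the maps of the
  matched pair.  They are chosen so that the bijection preserves all operations; hence the axioms
  for the bicrossed product are pulled back from \<open>E\<close>.  Conversely, \<open>x \<mapsto> (x, 0)\<close> and
  \<open>u \<mapsto> (0, u)\<close> embed \<open>Z\<close> and \<open>V\<close> into any bicrossed product as complementary subalgebras.
\<close>

section \<open>Linear algebra on carriers\<close>

lemma vector_space_onD:
  assumes "vector_space_on V"
  shows vs_module: "module (smult V)"
    and vs_zero: "0 \<in> carr V"
    and vs_add: "x \<in> carr V \<Longrightarrow> y \<in> carr V \<Longrightarrow> x + y \<in> carr V"
    and vs_smult: "x \<in> carr V \<Longrightarrow> smult V c x \<in> carr V"
    and vs_uminus: "x \<in> carr V \<Longrightarrow> - x \<in> carr V"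
    and vs_smult_add: "smult V c (x + y) = smult V c x + smult V c y"
proof -
  show m: "module (smult V)"
    using assms by (simp add: vector_space_on_def module_iff_vector_space)
  have s: "module.subspace (smult V) (carr V)"
    using assms by (simp add: vector_space_on_def)
  show "0 \<in> carr V" using module.subspace_0[OF m s] .
  show "x \<in> carr V \<Longrightarrow> y \<in> carr V \<Longrightarrow> x + y \<in> carr V" using module.subspace_add[OF m s] .
  show "x \<in> carr V \<Longrightarrow> smult V c x \<in> carr V" using module.subspace_scale[OF m s] .
  show "x \<in> carr V \<Longrightarrow> - x \<in> carr V" using module.subspace_neg[OF m s] .
  show "smult V c (x + y) = smult V c x + smult V c y" using m by (simp add: module_def)
qed

lemma linear_mapD:
  assumes "linear_map V W f"
  shows lin_in: "x \<in> carr V \<Longrightarrow> f x \<in> carr W"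
    and lin_add: "x \<in> carr V \<Longrightarrow> y \<in> carr V \<Longrightarrow> f (x + y) = f x + f y"
    and lin_smult: "x \<in> carr V \<Longrightarrow> f (smult V c x) = smult W c (f x)"
  using assms by (auto simp: linear_map_def)

lemma lin_zero:
  assumes "linear_map V W f" "vector_space_on V"
  shows "f 0 = 0"
  using lin_add[OF assms(1), of 0 0] vs_zero[OF assms(2)] by simp

lemma linear_mapI:
  assumes "\<And>x. x \<in> carr V \<Longrightarrow> f x \<in> carr W"
    and "\<And>x y. x \<in> carr V \<Longrightarrow> y \<in> carr V \<Longrightarrow> f (x + y) = f x + f y"
    and "\<And>c x. x \<in> carr V \<Longrightarrow> f (smult V c x) = smult W c (f x)"
  shows "linear_map V W f"
  using assms by (auto simp: linear_map_def)

lemma linear_map_comp: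
  assumes "linear_map U V f" "linear_map V W g"
  shows "linear_map U W (\<lambda>x. g (f x))"
  by (rule linear_mapI) (simp_all add: linear_mapD[OF assms(1)] linear_mapD[OF assms(2)])

text \<open>On \<open>carr W\<close> the value of \<open>inv_into\<close> is the only element of
  \<open>carr V\<close> with the given image. So a linearity equation for the inverse holds once its
  right-hand side is seen to lie in \<open>carr V\<close> and to have the correct image under
  \<open>f\<close>.\<close>

lemma linear_map_inv_into:
  assumes V: "vector_space_on V" and lin: "linear_map V W f" and bij: "bij_betw f (carr V) (carr W)"
  shows "linear_map W V (inv_into (carr V) f)"
proof -
  let ?h = "inv_into (carr V) f"
  have h: "?h y \<in> carr V" "f (?h y) = y" if "y \<in> carr W" for y
    using that bij by (auto simp: bij_betw_def inv_into_into f_inv_into_f)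
  have hI: "?h y = x" if "x \<in> carr V" "f x = y" for x y
    using that bij by (auto simp: bij_betw_def)
  show ?thesis
  proof (rule linear_mapI)
    show "?h (x + y) = ?h x + ?h y" if "x \<in> carr W" "y \<in> carr W" for x y
      by (rule hI) (use that h in \<open>simp_all add: lin_add[OF lin] vs_add[OF V]\<close>)
    show "?h (smult W c x) = smult V c (?h x)" if "x \<in> carr W" for c x
      by (rule hI) (use that h in \<open>simp_all add: lin_smult[OF lin] vs_smult[OF V]\<close>)
  qed (use h in auto)
qed

section \<open>Bilinear maps on carriers\<close>

lemma bilinear_mapD:
  assumes "bilinear_map U V W m"
  shows bil_left: "x \<in> carr U \<Longrightarrow> linear_map V W (\<lambda>y. m x y)"
    and bil_right: "y \<in> carr V \<Longrightarrow> linear_map U W (\<lambda>x. m x y)"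
    and bil_in: "x \<in> carr U \<Longrightarrow> y \<in> carr V \<Longrightarrow> m x y \<in> carr W"
  using assms by (auto simp: bilinear_map_def linear_map_def)

lemma bil_add_right:
  "bilinear_map U V W m \<Longrightarrow> x \<in> carr U \<Longrightarrow> y \<in> carr V \<Longrightarrow> z \<in> carr V
    \<Longrightarrow> m x (y + z) = m x y + m x z"
  using lin_add[OF bil_left] .

lemma bil_add_left:
  "bilinear_map U V W m \<Longrightarrow> x \<in> carr U \<Longrightarrow> y \<in> carr U \<Longrightarrow> z \<in> carr V
    \<Longrightarrow> m (x + y) z = m x z + m y z"
  using lin_add[OF bil_right] .

lemma bil_zero:
  assumes "bilinear_map U V W m" "vector_space_on U" "vector_space_on V"
  shows bil_zero_right: "x \<in> carr U \<Longrightarrow> m x 0 = 0"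
    and bil_zero_left: "y \<in> carr V \<Longrightarrow> m 0 y = 0"
  using lin_zero[OF bil_left[OF assms(1)] assms(3)] lin_zero[OF bil_right[OF assms(1)] assms(2)]
  by auto

text \<open>Meant for the sixteen maps of a matched pair: \<open>f\<close> and \<open>g\<close> are
  embeddings of the summands into \<open>E\<close>, \<open>m\<close> is a product or an action of
  \<open>E\<close>, and \<open>p\<close> is a coordinate of the decomposition.\<close>

lemma bilinear_map_comp:
  assumes m: "bilinear_map U V W m"
    and "linear_map U' U f" "linear_map V' V g" "linear_map W W' p"
  shows "bilinear_map U' V' W' (\<lambda>x y. p (m (f x) (g y)))"
  unfolding bilinear_map_def
proof (intro conjI ballI)
  fix x assume "x \<in> carr U'"
  then have "f x \<in> carr U" using lin_in[OF assms(2)] by simp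
  from linear_map_comp[OF linear_map_comp[OF assms(3) bil_left[OF m this]] assms(4)]
  show "linear_map V' W' (\<lambda>y. p (m (f x) (g y)))" .
next
  fix y assume "y \<in> carr V'"
  then have "g y \<in> carr V" using lin_in[OF assms(3)] by simp
  from linear_map_comp[OF linear_map_comp[OF assms(2) bil_right[OF m this]] assms(4)]
  show "linear_map U' W' (\<lambda>x. p (m (f x) (g y)))" .
qed

text \<open>Both sides of a linearity equation for \<open>f\<close> lie in \<open>carr W\<close> and
  have the same image under \<open>h\<close>, so injectivity of \<open>h\<close> on
  \<open>carr W\<close> cancels it.\<close>

lemma linear_map_cancel:
  assumes "vector_space_on V" "linear_map W X h" "inj_on h (carr W)" "vector_space_on W"
    and f: "\<And>x. x \<in> carr V \<Longrightarrow> f x \<in> carr W"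
    and hf: "linear_map V X (\<lambda>x. h (f x))"
  shows "linear_map V W f"
proof (rule linear_mapI)
  show "f (x + y) = f x + f y" if "x \<in> carr V" "y \<in> carr V" for x y
    by (rule inj_onD[OF assms(3)])
      (use that in \<open>simp_all add: lin_add[OF hf] lin_add[OF assms(2)] f
        vs_add[OF assms(1)] vs_add[OF assms(4)]\<close>)
  show "f (smult V c x) = smult W c (f x)" if "x \<in> carr V" for c x
    by (rule inj_onD[OF assms(3)])
      (use that in \<open>simp_all add: lin_smult[OF hf] lin_smult[OF assms(2)] f
        vs_smult[OF assms(1)] vs_smult[OF assms(4)]\<close>)
qed (use f in auto)

lemma linear_map_cong:
  assumes "vector_space_on V" "linear_map V W g" "\<And>x. x \<in> carr V \<Longrightarrow> f x = g x"
  shows "linear_map V W f"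
  by (rule linear_mapI)
    (simp_all add: assms(3) linear_mapD[OF assms(2)] vs_add[OF assms(1)] vs_smult[OF assms(1)])

text \<open>With one argument fixed, \<open>h\<close> after \<open>m\<close> agrees with a
  composition of linear maps obtained from \<open>m'\<close>, and \<open>linear_map_cancel\<close>
  then removes \<open>h\<close>. In this way an operation inherits bilinearity from an ambient
  algebra.\<close>

lemma bilinear_map_pullback:
  assumes vs: "vector_space_on U" "vector_space_on V" "vector_space_on W"
    and cl: "\<And>x y. x \<in> carr U \<Longrightarrow> y \<in> carr V \<Longrightarrow> m x y \<in> carr W"
    and lin: "linear_map U U' f" "linear_map V V' g" "linear_map W W' h" and inj: "inj_on h (carr W)"
    and m': "bilinear_map U' V' W' m'"
    and eq: "\<And>x y. x \<in> carr U \<Longrightarrow> y \<in> carr V \<Longrightarrow> h (m x y) = m' (f x) (g y)"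
  shows "bilinear_map U V W m"
  unfolding bilinear_map_def
proof (intro conjI ballI)
  fix x assume x: "x \<in> carr U"
  have "linear_map V W' (\<lambda>y. h (m x y))"
    by (rule linear_map_cong[OF vs(2)
          linear_map_comp[OF lin(2) bil_left[OF m' lin_in[OF lin(1) x]]] eq[OF x]])
  then show "linear_map V W (\<lambda>y. m x y)"
    by (rule linear_map_cancel[OF vs(2) lin(3) inj vs(3), rotated]) (rule cl[OF x])
next
  fix y assume y: "y \<in> carr V"
  have "linear_map U W' (\<lambda>x. h (m x y))"
    by (rule linear_map_cong[OF vs(1)
          linear_map_comp[OF lin(1) bil_right[OF m' lin_in[OF lin(2) y]]] eq[OF _ y]])
  then show "linear_map U W (\<lambda>x. m x y)"
    by (rule linear_map_cancel[OF vs(1) lin(3) inj vs(3), rotated]) (rule cl[OF _ y])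
qed

section \<open>Embeddings and transport of structure\<close>

lemma zinbiel_algebraD:
  assumes "zinbiel_algebra Z"
  shows za_vs: "vector_space_on Z" and za_bil: "bilinear_map Z Z Z (mul Z)"
    and za_mul: "x \<in> carr Z \<Longrightarrow> y \<in> carr Z \<Longrightarrow> x \<cdot>\<^bsub>Z\<^esub> y \<in> carr Z"
    and za_assoc: "x \<in> carr Z \<Longrightarrow> y \<in> carr Z \<Longrightarrow> z \<in> carr Z
      \<Longrightarrow> (x \<cdot>\<^bsub>Z\<^esub> y) \<cdot>\<^bsub>Z\<^esub> z = x \<cdot>\<^bsub>Z\<^esub> (y \<cdot>\<^bsub>Z\<^esub> z + z \<cdot>\<^bsub>Z\<^esub> y)"
  using assms bil_in[of Z Z Z "mul Z" x y] by (auto simp: zinbiel_algebra_def)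

text \<open>Under \<open>f\<close> the identity in \<open>Z\<close> becomes the same identity in
  \<open>W\<close>. Closure is a separate hypothesis because injectivity is given on
  \<open>carr Z\<close>: both sides must be known to lie there before \<open>f\<close> is
  cancelled.\<close>

lemma zinbiel_algebra_pullback:
  assumes Z: "vector_space_on Z" and cl: "\<And>x y. x \<in> carr Z \<Longrightarrow> y \<in> carr Z \<Longrightarrow> x \<cdot>\<^bsub>Z\<^esub> y \<in> carr Z"
    and f: "zinbiel_hom Z W f" and inj: "inj_on f (carr Z)" and W: "zinbiel_algebra W"
  shows "zinbiel_algebra Z"
proof -
  have lin: "linear_map Z W f"
    and mul: "\<And>x y. x \<in> carr Z \<Longrightarrow> y \<in> carr Z \<Longrightarrow> f (x \<cdot>\<^bsub>Z\<^esub> y) = f x \<cdot>\<^bsub>W\<^esub> f y"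
    using f by (auto simp: zinbiel_hom_def)
  have "bilinear_map Z Z Z (mul Z)"
    using bilinear_map_pullback[OF Z Z Z cl lin lin lin inj za_bil[OF W] mul] .
  moreover have "(x \<cdot>\<^bsub>Z\<^esub> y) \<cdot>\<^bsub>Z\<^esub> z = x \<cdot>\<^bsub>Z\<^esub> (y \<cdot>\<^bsub>Z\<^esub> z + z \<cdot>\<^bsub>Z\<^esub> y)"
    if "x \<in> carr Z" "y \<in> carr Z" "z \<in> carr Z" for x y z
    by (rule inj_onD[OF inj])
      (use that in \<open>simp_all add: mul lin_add[OF lin] lin_in[OF lin] cl vs_add[OF Z] za_assoc[OF W]\<close>)
  ultimately show ?thesis using Z by (simp add: zinbiel_algebra_def)
qed

text \<open>An isomorphism onto its image. Without surjectivity, one notion serves for isomorphisms,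
  for inclusions of subalgebras and for the maps of both factors into a bicrossed product.\<close>

definition zinbiel2_embedding ::
  "('k::field, 'a1::ab_group_add, 'a0::ab_group_add) zinbiel2
    \<Rightarrow> ('k, 'b1::ab_group_add, 'b0::ab_group_add) zinbiel2
    \<Rightarrow> ('a1 \<Rightarrow> 'b1) \<Rightarrow> ('a0 \<Rightarrow> 'b0) \<Rightarrow> bool" where
  "zinbiel2_embedding Z W f1 f0 \<longleftrightarrow>
     zinbiel_hom (alg1 Z) (alg1 W) f1 \<and> inj_on f1 (carr (alg1 Z)) \<and>
     zinbiel_hom (alg0 Z) (alg0 W) f0 \<and> inj_on f0 (carr (alg0 Z)) \<and>
     (\<forall>x1\<in>carr (alg1 Z). smap W (f1 x1) = f0 (smap Z x1)) \<and>
     (\<forall>x0\<in>carr (alg0 Z). \<forall>x1\<in>carr (alg1 Z).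
        f1 (lact Z x0 x1) = lact W (f0 x0) (f1 x1) \<and>
        f1 (ract Z x1 x0) = ract W (f1 x1) (f0 x0))"

lemma zinbiel2_iso_iff_embedding:
  "zinbiel2_iso Z W f1 f0 \<longleftrightarrow> zinbiel2_embedding Z W f1 f0 \<and>
     f1 ` carr (alg1 Z) = carr (alg1 W) \<and> f0 ` carr (alg0 Z) = carr (alg0 W)"
  by (auto simp: zinbiel2_iso_def zinbiel2_embedding_def bij_betw_def)

lemma zinbiel2_embeddingD:
  assumes "zinbiel2_embedding Z W f1 f0"
  shows emb_lin1: "linear_map (alg1 Z) (alg1 W) f1"
    and emb_lin0: "linear_map (alg0 Z) (alg0 W) f0"
    and emb_inj1: "inj_on f1 (carr (alg1 Z))"
    and emb_inj0: "inj_on f0 (carr (alg0 Z))"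
    and emb_mul1: "x1 \<in> carr (alg1 Z) \<Longrightarrow> y1 \<in> carr (alg1 Z)
      \<Longrightarrow> f1 (x1 \<cdot>\<^bsub>alg1 Z\<^esub> y1) = f1 x1 \<cdot>\<^bsub>alg1 W\<^esub> f1 y1"
    and emb_mul0: "x0 \<in> carr (alg0 Z) \<Longrightarrow> y0 \<in> carr (alg0 Z)
      \<Longrightarrow> f0 (x0 \<cdot>\<^bsub>alg0 Z\<^esub> y0) = f0 x0 \<cdot>\<^bsub>alg0 W\<^esub> f0 y0"
    and emb_smap: "x1 \<in> carr (alg1 Z) \<Longrightarrow> f0 (smap Z x1) = smap W (f1 x1)"
    and emb_lact: "x0 \<in> carr (alg0 Z) \<Longrightarrow> x1 \<in> carr (alg1 Z)
      \<Longrightarrow> f1 (lact Z x0 x1) = lact W (f0 x0) (f1 x1)"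
    and emb_ract: "x0 \<in> carr (alg0 Z) \<Longrightarrow> x1 \<in> carr (alg1 Z)
      \<Longrightarrow> f1 (ract Z x1 x0) = ract W (f1 x1) (f0 x0)"
  using assms by (auto simp: zinbiel2_embedding_def zinbiel_hom_def)

section \<open>Zinbiel 2-algebras and their pullback along embeddings\<close>

lemma zinbiel_2_algebraD:
  assumes "zinbiel_2_algebra Z"
  shows z2_alg1: "zinbiel_algebra (alg1 Z)" and z2_alg0: "zinbiel_algebra (alg0 Z)"
    and z2_smap_lin: "linear_map (alg1 Z) (alg0 Z) (smap Z)"
    and z2_lact_bil: "bilinear_map (alg0 Z) (alg1 Z) (alg1 Z) (lact Z)"
    and z2_ract_bil: "bilinear_map (alg1 Z) (alg0 Z) (alg1 Z) (ract Z)"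
  using assms
  by (auto simp: zinbiel_2_algebra_def zinbiel_hom_def zinbiel_action_def zinbiel_bimodule_def)

lemmas z2_vs1 = za_vs[OF z2_alg1]
lemmas z2_vs0 = za_vs[OF z2_alg0]
lemmas z2_mul1 = za_mul[OF z2_alg1]
lemmas z2_mul0 = za_mul[OF z2_alg0]
lemmas z2_smap = lin_in[OF z2_smap_lin]
lemmas z2_lact = bil_in[OF z2_lact_bil]
lemmas z2_ract = bil_in[OF z2_ract_bil]

text \<open>Every identity in the definition is an equation in degree 1 or 0, and applying
  \<open>f1\<close> or \<open>f0\<close> turns it into the same identity in \<open>W\<close>. The
  embedding describes the images of the values of the operations, not whether these values lie in
  the carriers, so closure is assumed separately. Image algebras and bicrossed products get their
  axioms from here.\<close>

lemma zinbiel_2_algebra_pullback: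
  assumes vs: "vector_space_on (alg1 Z)" "vector_space_on (alg0 Z)"
    and cl: "\<And>x1 y1. x1 \<in> carr (alg1 Z) \<Longrightarrow> y1 \<in> carr (alg1 Z) \<Longrightarrow> x1 \<cdot>\<^bsub>alg1 Z\<^esub> y1 \<in> carr (alg1 Z)"
      "\<And>x0 y0. x0 \<in> carr (alg0 Z) \<Longrightarrow> y0 \<in> carr (alg0 Z) \<Longrightarrow> x0 \<cdot>\<^bsub>alg0 Z\<^esub> y0 \<in> carr (alg0 Z)"
      "\<And>x1. x1 \<in> carr (alg1 Z) \<Longrightarrow> smap Z x1 \<in> carr (alg0 Z)"
      "\<And>x0 x1. x0 \<in> carr (alg0 Z) \<Longrightarrow> x1 \<in> carr (alg1 Z) \<Longrightarrow> lact Z x0 x1 \<in> carr (alg1 Z)"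
      "\<And>x1 x0. x1 \<in> carr (alg1 Z) \<Longrightarrow> x0 \<in> carr (alg0 Z) \<Longrightarrow> ract Z x1 x0 \<in> carr (alg1 Z)"
    and emb: "zinbiel2_embedding Z W f1 f0" and W: "zinbiel_2_algebra W"
  shows "zinbiel_2_algebra Z"
proof -
  note lin1 = emb_lin1[OF emb] and lin0 = emb_lin0[OF emb]
  note inj1 = inj_onD[OF emb_inj1[OF emb]] and inj0 = inj_onD[OF emb_inj0[OF emb]]
  note f = emb_mul1[OF emb] emb_mul0[OF emb] emb_smap[OF emb] emb_lact[OF emb] emb_ract[OF emb]
    lin_add[OF lin1] lin_add[OF lin0] lin_smult[OF lin1] lin_smult[OF lin0]
  note mem = cl lin_in[OF lin1] lin_in[OF lin0] vs_add[OF vs(1)] vs_add[OF vs(2)]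
    vs_smult[OF vs(1)] vs_smult[OF vs(2)]
  have hom: "zinbiel_hom (alg1 Z) (alg1 W) f1" "zinbiel_hom (alg0 Z) (alg0 W) f0"
    using emb by (auto simp: zinbiel2_embedding_def)
  have A1: "zinbiel_algebra (alg1 Z)"
    using zinbiel_algebra_pullback[OF vs(1) cl(1) hom(1) emb_inj1[OF emb] z2_alg1[OF W]] .
  have A0: "zinbiel_algebra (alg0 Z)"
    using zinbiel_algebra_pullback[OF vs(2) cl(2) hom(2) emb_inj0[OF emb] z2_alg0[OF W]] .
  have l: "bilinear_map (alg0 Z) (alg1 Z) (alg1 Z) (lact Z)"
    using bilinear_map_pullback[OF vs(2,1,1) cl(4) lin0 lin1 lin1 emb_inj1[OF emb]
        z2_lact_bil[OF W] emb_lact[OF emb]] .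
  have r: "bilinear_map (alg1 Z) (alg0 Z) (alg1 Z) (ract Z)"
    by (rule bilinear_map_pullback[OF vs(1,2,1) cl(5) lin1 lin0 lin1 emb_inj1[OF emb]
        z2_ract_bil[OF W]]) (simp_all add: emb_ract[OF emb])
  have Wax: "zinbiel_hom (alg1 W) (alg0 W) (smap W)"
    "zinbiel_action (alg0 W) (alg1 W) (lact W) (ract W)"
    "zinbiel_bimodule (alg0 W) (alg1 W) (lact W) (ract W)"
    using W by (auto simp: zinbiel_2_algebra_def zinbiel_action_def)
  note Wb = Wax(3)[unfolded zinbiel_bimodule_def]
  note Wa = Wax(2)[unfolded zinbiel_action_def]
  note Wh = Wax(1)[unfolded zinbiel_hom_def]
  \<comment> \<open>Equations with values in degree 0 are tested by \<open>f0\<close>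
    (\<open>inj0\<close>), those with values in degree 1 by \<open>f1\<close> (\<open>inj1\<close>).
    The membership goal of \<open>linear_mapI\<close> is no equation, so the optional
    \<open>inj0\<close> is skipped on it.\<close>
  have sl: "linear_map (alg1 Z) (alg0 Z) (smap Z)"
    by (rule linear_mapI; (rule inj0)?)
      (simp_all add: f mem lin_add[OF z2_smap_lin[OF W]] lin_smult[OF z2_smap_lin[OF W]])
  have h: "zinbiel_hom (alg1 Z) (alg0 Z) (smap Z)"
    unfolding zinbiel_hom_def
    by (intro conjI ballI sl; rule inj0) (use Wh in \<open>simp_all add: f mem\<close>)
  have b: "zinbiel_bimodule (alg0 Z) (alg1 Z) (lact Z) (ract Z)"
    unfolding zinbiel_bimodule_def
    by (intro conjI ballI A0 vs(1) l r; rule inj1) (use Wb in \<open>simp_all add: f mem\<close>)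
  have a: "zinbiel_action (alg0 Z) (alg1 Z) (lact Z) (ract Z)"
    unfolding zinbiel_action_def
    by (intro conjI ballI A0 A1 b; rule inj1) (use Wa in \<open>simp_all add: f mem\<close>)
  have s: "smap Z (lact Z x0 x1) = x0 \<cdot>\<^bsub>alg0 Z\<^esub> smap Z x1"
    "smap Z (ract Z x1 x0) = smap Z x1 \<cdot>\<^bsub>alg0 Z\<^esub> x0"
    if "x0 \<in> carr (alg0 Z)" "x1 \<in> carr (alg1 Z)" for x0 x1
    by (rule inj0; use that W in \<open>simp add: f mem zinbiel_2_algebra_def\<close>)+
  have p: "lact Z (smap Z x1) y1 = x1 \<cdot>\<^bsub>alg1 Z\<^esub> y1"
    "x1 \<cdot>\<^bsub>alg1 Z\<^esub> y1 = ract Z x1 (smap Z y1)"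
    if "x1 \<in> carr (alg1 Z)" "y1 \<in> carr (alg1 Z)" for x1 y1
    by (rule inj1; use that W in \<open>simp add: f mem zinbiel_2_algebra_def\<close>)+
  show ?thesis
    unfolding zinbiel_2_algebra_def using A1 A0 h a s p by blast
qed

section \<open>Composing embeddings and inverting isomorphisms\<close>

lemma zinbiel2_embedding_comp:
  assumes f: "zinbiel2_embedding A B f1 f0" and g: "zinbiel2_embedding B C g1 g0"
  shows "zinbiel2_embedding A C (\<lambda>x. g1 (f1 x)) (\<lambda>x. g0 (f0 x))"
proof -
  note mem = lin_in[OF emb_lin1[OF f]] lin_in[OF emb_lin0[OF f]]
  have "inj_on (\<lambda>x. g1 (f1 x)) (carr (alg1 A))" "inj_on (\<lambda>x. g0 (f0 x)) (carr (alg0 A))"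
    using emb_inj1[OF f] emb_inj0[OF f] emb_inj1[OF g] emb_inj0[OF g] mem
    by (auto simp: inj_on_def)
  then show ?thesis
    unfolding zinbiel2_embedding_def zinbiel_hom_def
    by (simp add: linear_map_comp[OF emb_lin1[OF f] emb_lin1[OF g]]
        linear_map_comp[OF emb_lin0[OF f] emb_lin0[OF g]] mem
        emb_mul1[OF f] emb_mul0[OF f] emb_smap[OF f] emb_lact[OF f] emb_ract[OF f]
        emb_mul1[OF g] emb_mul0[OF g] emb_smap[OF g] emb_lact[OF g] emb_ract[OF g])
qed

text \<open>An operation of \<open>Z\<close> applied to preimages stays in the carrier, as
  \<open>Z\<close> is a Zinbiel 2-algebra, and \<open>f1\<close> or \<open>f0\<close> sends the
  result to the operation of \<open>W\<close>; it is therefore the preimage chosen by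
  \<open>inv_into\<close>.\<close>

lemma zinbiel2_iso_inv_into:
  assumes Z: "zinbiel_2_algebra Z" and iso: "zinbiel2_iso Z W f1 f0"
  shows "zinbiel2_iso W Z (inv_into (carr (alg1 Z)) f1) (inv_into (carr (alg0 Z)) f0)"
proof -
  let ?h1 = "inv_into (carr (alg1 Z)) f1" and ?h0 = "inv_into (carr (alg0 Z)) f0"
  have emb: "zinbiel2_embedding Z W f1 f0"
    and bij: "bij_betw f1 (carr (alg1 Z)) (carr (alg1 W))" "bij_betw f0 (carr (alg0 Z)) (carr (alg0 W))"
    using iso by (auto simp: zinbiel2_iso_iff_embedding zinbiel2_embedding_def bij_betw_def)
  have h1: "?h1 y \<in> carr (alg1 Z)" "f1 (?h1 y) = y" if "y \<in> carr (alg1 W)" for y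
    using that bij by (auto simp: bij_betw_def inv_into_into f_inv_into_f)
  have h0: "?h0 y \<in> carr (alg0 Z)" "f0 (?h0 y) = y" if "y \<in> carr (alg0 W)" for y
    using that bij by (auto simp: bij_betw_def inv_into_into f_inv_into_f)
  have I1: "?h1 y = x" if "x \<in> carr (alg1 Z)" "f1 x = y" for x y
    using that bij by (auto simp: bij_betw_def)
  have I0: "?h0 y = x" if "x \<in> carr (alg0 Z)" "f0 x = y" for x y
    using that bij by (auto simp: bij_betw_def)
  note s = h1 h0 z2_mul1[OF Z] z2_mul0[OF Z] z2_smap[OF Z] z2_lact[OF Z] z2_ract[OF Z]
    emb_mul1[OF emb] emb_mul0[OF emb] emb_smap[OF emb] emb_lact[OF emb] emb_ract[OF emb]
  show ?thesis
    unfolding zinbiel2_iso_def zinbiel_hom_def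
  proof (intro conjI ballI)
    show "linear_map (alg1 W) (alg1 Z) ?h1" "linear_map (alg0 W) (alg0 Z) ?h0"
      using linear_map_inv_into[OF z2_vs1[OF Z] emb_lin1[OF emb] bij(1)]
        linear_map_inv_into[OF z2_vs0[OF Z] emb_lin0[OF emb] bij(2)] .
    show "bij_betw ?h1 (carr (alg1 W)) (carr (alg1 Z))" "bij_betw ?h0 (carr (alg0 W)) (carr (alg0 Z))"
      using bij by (simp_all add: bij_betw_inv_into)
    show "smap Z (?h1 x) = ?h0 (smap W x)" if "x \<in> carr (alg1 W)" for x
      using that by (intro I0[symmetric]) (simp_all add: s)
  qed ((rule I1 I0; simp add: s)+)
qed

section \<open>Images of embeddings as subalgebras\<close>

definition image_algebra ::
  "('k::field, 'a1::ab_group_add, 'a0::ab_group_add) zinbiel2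
    \<Rightarrow> ('k, 'b1::ab_group_add, 'b0::ab_group_add) zinbiel2
    \<Rightarrow> ('a1 \<Rightarrow> 'b1) \<Rightarrow> ('a0 \<Rightarrow> 'b0) \<Rightarrow> ('k, 'b1, 'b0) zinbiel2" where
  "image_algebra Z W f1 f0 =
     W\<lparr> alg1 := (alg1 W)\<lparr> carr := f1 ` carr (alg1 Z) \<rparr>,
        alg0 := (alg0 W)\<lparr> carr := f0 ` carr (alg0 Z) \<rparr> \<rparr>"

lemma image_algebra_simps [simp]:
  "carr (alg1 (image_algebra Z W f1 f0)) = f1 ` carr (alg1 Z)"
  "carr (alg0 (image_algebra Z W f1 f0)) = f0 ` carr (alg0 Z)"
  "smult (alg1 (image_algebra Z W f1 f0)) = smult (alg1 W)"
  "smult (alg0 (image_algebra Z W f1 f0)) = smult (alg0 W)"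
  "mul (alg1 (image_algebra Z W f1 f0)) = mul (alg1 W)"
  "mul (alg0 (image_algebra Z W f1 f0)) = mul (alg0 W)"
  "smap (image_algebra Z W f1 f0) = smap W"
  "lact (image_algebra Z W f1 f0) = lact W"
  "ract (image_algebra Z W f1 f0) = ract W"
  by (simp_all add: image_algebra_def)

lemma vector_space_on_image:
  assumes V: "vector_space_on V" and W: "vector_space_on W" and f: "linear_map V W f"
    and U: "carr U = f ` carr V" "smult U = smult W"
  shows "vector_space_on U"
proof -
  have "module.subspace (smult W) (f ` carr V)"
  proof (rule module.subspaceI[OF vs_module[OF W]])
    show "0 \<in> f ` carr V" using lin_zero[OF f V] vs_zero[OF V] by force
    show "x + y \<in> f ` carr V" if "x \<in> f ` carr V" "y \<in> f ` carr V" for x y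
      using that lin_add[OF f, symmetric] vs_add[OF V] by auto
    show "smult W c x \<in> f ` carr V" if "x \<in> f ` carr V" for c x
      using that lin_smult[OF f, symmetric] vs_smult[OF V] by auto
  qed
  then show ?thesis using W U by (simp add: vector_space_on_def)
qed

text \<open>The image keeps the operations of \<open>W\<close> on smaller carriers, so the identity
  embeds it into \<open>W\<close> and its axioms are pulled back from there. Closure comes from
  reading the homomorphism equations backwards: a product of images is the image of a
  product.\<close>

lemma image_algebra_subalgebra:
  assumes Z: "zinbiel_2_algebra Z" and W: "zinbiel_2_algebra W"
    and emb: "zinbiel2_embedding Z W f1 f0"
  shows "zinbiel2_subalgebra (image_algebra Z W f1 f0) W"
    and "zinbiel2_iso Z (image_algebra Z W f1 f0) f1 f0"
proof -
  let ?I = "image_algebra Z W f1 f0"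
  note lin1 = emb_lin1[OF emb] and lin0 = emb_lin0[OF emb]
  have sub: "f1 ` carr (alg1 Z) \<subseteq> carr (alg1 W)" "f0 ` carr (alg0 Z) \<subseteq> carr (alg0 W)"
    using lin_in[OF lin1] lin_in[OF lin0] by auto
  have incl: "zinbiel2_embedding ?I W (\<lambda>x. x) (\<lambda>x. x)"
    using sub by (auto simp: zinbiel2_embedding_def zinbiel_hom_def linear_map_def)
  have I: "zinbiel_2_algebra ?I"
  proof (rule zinbiel_2_algebra_pullback[OF _ _ _ _ _ _ _ incl W])
    show "vector_space_on (alg1 ?I)"
      by (rule vector_space_on_image[OF z2_vs1[OF Z] z2_vs1[OF W] lin1]) simp_all
    show "vector_space_on (alg0 ?I)"
      by (rule vector_space_on_image[OF z2_vs0[OF Z] z2_vs0[OF W] lin0]) simp_all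
  qed (auto simp: emb_mul1[OF emb, symmetric] emb_mul0[OF emb, symmetric]
      emb_smap[OF emb, symmetric] emb_lact[OF emb, symmetric] emb_ract[OF emb, symmetric]
      intro!: imageI z2_mul1[OF Z] z2_mul0[OF Z] z2_smap[OF Z] z2_lact[OF Z] z2_ract[OF Z])
  show "zinbiel2_subalgebra ?I W"
    using I W sub z2_alg1[OF I] z2_alg0[OF I] z2_alg1[OF W] z2_alg0[OF W]
    by (simp add: zinbiel2_subalgebra_def zinbiel_subalgebra_def)
  show "zinbiel2_iso Z ?I f1 f0"
    using emb by (auto simp: zinbiel2_iso_iff_embedding zinbiel2_embedding_def
        zinbiel_hom_def linear_map_def)
qed

text \<open>Replaces an isomorphic copy inside \<open>E\<close> by a single map into
  \<open>E\<close>: the isomorphism followed by the inclusion, which is the identity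
  function.\<close>

lemma subalgebra_embedding:
  assumes "zinbiel2_subalgebra A E" "zinbiel2_iso Z A f1 f0"
  shows "zinbiel2_embedding Z E f1 f0"
proof -
  have "zinbiel2_embedding A E (\<lambda>x. x) (\<lambda>x. x)"
    using assms(1) vs_add z2_vs1[of A] z2_vs0[of A]
    by (auto simp: zinbiel2_subalgebra_def zinbiel_subalgebra_def
        zinbiel2_embedding_def zinbiel_hom_def linear_map_def)
  then show ?thesis
    using zinbiel2_embedding_comp[of Z A f1 f0 E "\<lambda>x. x" "\<lambda>x. x"] assms(2)
    by (simp add: zinbiel2_iso_iff_embedding)
qed

section \<open>Direct sum decompositions\<close>

lemma lin_uminus:
  assumes "linear_map V W f" "vector_space_on V" "x \<in> carr V"
  shows "f (- x) = - f x"
proof -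
  have "f x + f (- x) = 0"
    using lin_add[OF assms(1,3) vs_uminus[OF assms(2,3)]] lin_zero[OF assms(1,2)] by simp
  then show ?thesis by (simp add: add_eq_0_iff)
qed

text \<open>Two representations of one element give \<open>f x - f x' = g u' - g u\<close>, an
  element of both images and hence zero; this is injectivity. Surjectivity is the sum
  condition.\<close>

lemma bij_betw_direct_sum:
  assumes vs: "vector_space_on A" "vector_space_on B"
    and f: "linear_map A E f" "inj_on f (carr A)" and g: "linear_map B E g" "inj_on g (carr B)"
    and sum: "carr E = {x + u |x u. x \<in> f ` carr A \<and> u \<in> g ` carr B}"
      "f ` carr A \<inter> g ` carr B = {0}"
  shows "bij_betw (\<lambda>(x, u). f x + g u) (carr A \<times> carr B) (carr E)"
  unfolding bij_betw_def
proof
  have "x = x' \<and> u = u'"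
    if m: "x \<in> carr A" "u \<in> carr B" "x' \<in> carr A" "u' \<in> carr B"
      and eq: "f x + g u = f x' + g u'" for x u x' u'
  proof -
    \<comment> \<open>Differences are written with unary minus to match closure under addition and
      negation.\<close>
    have d: "x + - x' \<in> carr A" "u' + - u \<in> carr B"
      using m by (simp_all only: vs_add[OF vs(1)] vs_add[OF vs(2)]
          vs_uminus[OF vs(1)] vs_uminus[OF vs(2)])
    have fd: "f (x + - x') = f x - f x'" and gd: "g (u' + - u) = g u' - g u"
      using m by (simp_all only: lin_add[OF f(1)] lin_add[OF g(1)] lin_uminus[OF f(1) vs(1)]
          lin_uminus[OF g(1) vs(2)] vs_uminus[OF vs(1)] vs_uminus[OF vs(2)]
          diff_conv_add_uminus)
    have same: "f x - f x' = g u' - g u"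
      using eq by (simp add: algebra_simps)
    have "f x - f x' \<in> f ` carr A \<inter> g ` carr B"
      using d fd gd same by (metis IntI imageI)
    then have "f x = f x'" "g u = g u'" using sum(2) same by auto
    then show ?thesis using f(2) g(2) m by (auto simp: inj_on_def)
  qed
  then show "inj_on (\<lambda>(x, u). f x + g u) (carr A \<times> carr B)"
    by (auto simp: inj_on_def)
  show "(\<lambda>(x, u). f x + g u) ` (carr A \<times> carr B) = carr E"
    unfolding sum(1) by force
qed

section \<open>Products of vector spaces and coordinates of a decomposition\<close>

lemma module_prod:
  assumes "module s" "module t"
  shows "module (\<lambda>c (x, u). (s c x, t c u))"
  using assms by (auto simp: module_def)

text \<open>\<open>U\<close> enters through its carrier and scalar multiplication, so that it can be
  a degree of a bicrossed product as well as a bare \<open>vspace\<close>.\<close>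

lemma vector_space_on_prod:
  assumes A: "vector_space_on A" and B: "vector_space_on B"
    and U: "carr U = carr A \<times> carr B"
      "smult U = (\<lambda>c (x, u). (smult A c x, smult B c u))"
  shows "vector_space_on U"
proof -
  have m: "module (smult U)"
    using module_prod[OF vs_module[OF A] vs_module[OF B]] U by simp
  have "module.subspace (smult U) (carr U)"
    by (rule module.subspaceI[OF m])
      (auto simp: U zero_prod_def vs_zero[OF A] vs_zero[OF B] vs_add[OF A] vs_add[OF B]
        vs_smult[OF A] vs_smult[OF B])
  with m show ?thesis by (simp add: vector_space_on_def module_iff_vector_space)
qed

lemma linear_map_sum:
  assumes E: "vector_space_on E" and f: "linear_map A E f" and g: "linear_map B E g"
    and U: "carr U = carr A \<times> carr B"
      "smult U = (\<lambda>c (x, u). (smult A c x, smult B c u))"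
  shows "linear_map U E (\<lambda>(x, u). f x + g u)"
  by (rule linear_mapI)
    (auto simp: U vs_add[OF E] vs_smult_add[OF E] linear_mapD[OF f] linear_mapD[OF g] algebra_simps)

text \<open>One degree of a direct sum decomposition, stated externally: bijectivity of the sum map
  encodes that the images of \<open>f\<close> and \<open>g\<close> span \<open>E\<close> and meet
  trivially.\<close>

locale decomposition =
  fixes A :: "('k::field, 'a::ab_group_add) zinbiel"
    and B :: "('k, 'b::ab_group_add) zinbiel"
    and E :: "('k, 'e::ab_group_add) zinbiel"
    and f :: "'a \<Rightarrow> 'e" and g :: "'b \<Rightarrow> 'e"
  assumes vs_A: "vector_space_on A" and vs_B: "vector_space_on B" and vs_E: "vector_space_on E"
    and lin_f: "linear_map A E f" and lin_g: "linear_map B E g"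
    and bij: "bij_betw (\<lambda>(x, u). f x + g u) (carr A \<times> carr B) (carr E)"
begin

text \<open>Its components \<open>pr1\<close> and \<open>pr2\<close> take values in \<open>A\<close>
  and \<open>B\<close> themselves, not in their copies inside \<open>E\<close>, as the maps of a
  matched pair require.\<close>

definition pr :: "'e \<Rightarrow> 'a \<times> 'b" where
  "pr = inv_into (carr A \<times> carr B) (\<lambda>(x, u). f x + g u)"

definition pr1 :: "'e \<Rightarrow> 'a" where "pr1 e = fst (pr e)"

definition pr2 :: "'e \<Rightarrow> 'b" where "pr2 e = snd (pr e)"

lemma pr_sum: "e \<in> carr E \<Longrightarrow> f (pr1 e) + g (pr2 e) = e"
  using bij f_inv_into_f[of e "\<lambda>(x, u). f x + g u" "carr A \<times> carr B"]
  by (simp add: pr1_def pr2_def pr_def bij_betw_def case_prod_unfold)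

lemma pr1_linear: "linear_map E A pr1" and pr2_linear: "linear_map E B pr2"
proof -
  \<comment> \<open>The product is given a vector space structure so that \<open>pr\<close> is the
    inverse of a linear bijection, hence linear.\<close>
  define U :: "('k, 'a \<times> 'b) vspace" where
    "U = \<lparr> carr = carr A \<times> carr B, smult = (\<lambda>c (x, u). (smult A c x, smult B c u)) \<rparr>"
  have U: "carr U = carr A \<times> carr B" "smult U = (\<lambda>c (x, u). (smult A c x, smult B c u))"
    by (simp_all add: U_def)
  have lin: "linear_map E U pr"
    unfolding pr_def U(1)[symmetric]
    by (rule linear_map_inv_into[OF vector_space_on_prod[OF vs_A vs_B U]
          linear_map_sum[OF vs_E lin_f lin_g U]]) (use bij U(1) in simp)
  have "linear_map U A fst" "linear_map U B snd"
    by (rule linear_mapI; auto simp: U)+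
  then show "linear_map E A pr1" "linear_map E B pr2"
    using linear_map_comp[OF lin] unfolding pr1_def pr2_def by blast+
qed

end

text \<open>The right-hand side expands into four terms: the two pure ones are \<open>f3 a\<close>
  and \<open>g3 b\<close>, and each mixed one is the sum of its two components. Separate
  decompositions for the arguments and the value let this cover both products and both actions,
  whose degrees differ.\<close>

lemma decomposition_bilinear_sum:
  assumes D1: "decomposition A1 B1 E1 f1 g1" and D2: "decomposition A2 B2 E2 f2 g2"
    and D3: "decomposition A3 B3 E3 f3 g3"
    and m: "bilinear_map E1 E2 E3 m"
    and x: "x \<in> carr A1" and y: "y \<in> carr A2" and u: "u \<in> carr B1" and v: "v \<in> carr B2"
    and a: "a \<in> carr A3" "f3 a = m (f1 x) (f2 y)" and b: "b \<in> carr B3" "g3 b = m (g1 u) (g2 v)"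
  defines "p \<equiv> decomposition.pr1 A3 B3 f3 g3" and "q \<equiv> decomposition.pr2 A3 B3 f3 g3"
  shows "f3 (a + p (m (f1 x) (g2 v)) + p (m (g1 u) (f2 y)))
       + g3 (q (m (f1 x) (g2 v)) + q (m (g1 u) (f2 y)) + b) = m (f1 x + g1 u) (f2 y + g2 v)"
    and "a + p (m (f1 x) (g2 v)) + p (m (g1 u) (f2 y)) \<in> carr A3"
    and "q (m (f1 x) (g2 v)) + q (m (g1 u) (f2 y)) + b \<in> carr B3"
proof -
  interpret D1: decomposition A1 B1 E1 f1 g1 by (rule D1)
  interpret D2: decomposition A2 B2 E2 f2 g2 by (rule D2)
  interpret D3: decomposition A3 B3 E3 f3 g3 by (rule D3)
  note D = p_def q_def
  have mem: "f1 x \<in> carr E1" "g1 u \<in> carr E1" "f2 y \<in> carr E2" "g2 v \<in> carr E2"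
    using x y u v lin_in[OF D1.lin_f] lin_in[OF D1.lin_g] lin_in[OF D2.lin_f] lin_in[OF D2.lin_g]
    by auto
  \<comment> \<open>The two mixed products, later reassembled from their coordinates.\<close>
  define r where "r = m (f1 x) (g2 v)"
  define s where "s = m (g1 u) (f2 y)"
  have rs: "r \<in> carr E3" "s \<in> carr E3"
    using mem bil_in[OF m] by (auto simp: r_def s_def)
  have pq: "p r \<in> carr A3" "p s \<in> carr A3" "q r \<in> carr B3" "q s \<in> carr B3"
    using rs lin_in[OF D3.pr1_linear] lin_in[OF D3.pr2_linear] by (auto simp: D)
  have sums: "f3 (p r) + g3 (q r) = r" "f3 (p s) + g3 (q s) = s"
    using rs D3.pr_sum by (auto simp: D)
  have "f3 (a + p r + p s) + g3 (q r + q s + b)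
      = f3 a + (f3 (p r) + g3 (q r)) + (f3 (p s) + g3 (q s)) + g3 b"
    using a b pq by (simp add: lin_add[OF D3.lin_f] lin_add[OF D3.lin_g]
        vs_add[OF D3.vs_A] vs_add[OF D3.vs_B] ac_simps)
  also have "\<dots> = f3 a + r + s + g3 b"
    by (simp only: sums)
  also have "\<dots> = m (f1 x + g1 u) (f2 y + g2 v)"
    using mem by (simp add: a b r_def s_def bil_add_left[OF m] bil_add_right[OF m]
        vs_add[OF D2.vs_E] ac_simps)
  finally show "f3 (a + p (m (f1 x) (g2 v)) + p (m (g1 u) (f2 y)))
       + g3 (q (m (f1 x) (g2 v)) + q (m (g1 u) (f2 y)) + b) = m (f1 x + g1 u) (f2 y + g2 v)"
    by (simp add: r_def s_def)
  show "a + p (m (f1 x) (g2 v)) + p (m (g1 u) (f2 y)) \<in> carr A3"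
    and "q (m (f1 x) (g2 v)) + q (m (g1 u) (f2 y)) + b \<in> carr B3"
    using a b pq vs_add[OF D3.vs_A] vs_add[OF D3.vs_B] by (auto simp: r_def s_def)
qed

section \<open>Bicrossed products and factorizations\<close>

lemma bicrossed_product_simps [simp]:
  "carr (alg1 (bicrossed_product Z V M)) = carr (alg1 Z) \<times> carr (alg1 V)"
  "carr (alg0 (bicrossed_product Z V M)) = carr (alg0 Z) \<times> carr (alg0 V)"
  "smult (alg1 (bicrossed_product Z V M)) = (\<lambda>c (x, u). (smult (alg1 Z) c x, smult (alg1 V) c u))"
  "smult (alg0 (bicrossed_product Z V M)) = (\<lambda>c (x, u). (smult (alg0 Z) c x, smult (alg0 V) c u))"
  "(x1, u1) \<cdot>\<^bsub>alg1 (bicrossed_product Z V M)\<^esub> (y1, v1) =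
     (x1 \<cdot>\<^bsub>alg1 Z\<^esub> y1 + lh1 M x1 v1 + rh1 M u1 y1, rt1 M x1 v1 + lt1 M u1 y1 + u1 \<cdot>\<^bsub>alg1 V\<^esub> v1)"
  "(x0, u0) \<cdot>\<^bsub>alg0 (bicrossed_product Z V M)\<^esub> (y0, v0) =
     (x0 \<cdot>\<^bsub>alg0 Z\<^esub> y0 + lh0 M x0 v0 + rh0 M u0 y0, rt0 M x0 v0 + lt0 M u0 y0 + u0 \<cdot>\<^bsub>alg0 V\<^esub> v0)"
  "smap (bicrossed_product Z V M) (x1, u1) = (smap Z x1, smap V u1)"
  "lact (bicrossed_product Z V M) (x0, u0) (x1, u1) =
     (lact Z x0 x1 + lh2 M x0 u1 + rh2 M u0 x1, rt2 M x0 u1 + lt2 M u0 x1 + lact V u0 u1)"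
  "ract (bicrossed_product Z V M) (x1, u1) (x0, u0) =
     (ract Z x1 x0 + lh3 M x1 u0 + rh3 M u1 x0, rt3 M x1 u0 + lt3 M u1 x0 + ract V u1 u0)"
  by (simp_all add: bicrossed_product_def)

section \<open>From a decomposition to a matched pair\<close>

lemma matched_pair_of_embeddings:
  assumes Z: "zinbiel_2_algebra Z" and V: "zinbiel_2_algebra V" and E: "zinbiel_2_algebra E"
    and f: "zinbiel2_embedding Z E f1 f0" and g: "zinbiel2_embedding V E g1 g0"
    and bij1: "bij_betw (\<lambda>(x, u). f1 x + g1 u) (carr (alg1 Z) \<times> carr (alg1 V)) (carr (alg1 E))"
    and bij0: "bij_betw (\<lambda>(x, u). f0 x + g0 u) (carr (alg0 Z) \<times> carr (alg0 V)) (carr (alg0 E))"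
  shows "\<exists>M. matched_pair Z V M \<and>
    zinbiel2_iso (bicrossed_product Z V M) E (\<lambda>(x, u). f1 x + g1 u) (\<lambda>(x, u). f0 x + g0 u)"
proof -
  let ?F1 = "\<lambda>(x, u). f1 x + g1 u" and ?F0 = "\<lambda>(x, u). f0 x + g0 u"
  have D1: "decomposition (alg1 Z) (alg1 V) (alg1 E) f1 g1"
    by (intro decomposition.intro z2_vs1 Z V E emb_lin1[OF f] emb_lin1[OF g] bij1)
  have D0: "decomposition (alg0 Z) (alg0 V) (alg0 E) f0 g0"
    by (intro decomposition.intro z2_vs0 Z V E emb_lin0[OF f] emb_lin0[OF g] bij0)
  interpret D1: decomposition "alg1 Z" "alg1 V" "alg1 E" f1 g1 by (rule D1)
  interpret D0: decomposition "alg0 Z" "alg0 V" "alg0 E" f0 g0 by (rule D0)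
  \<comment> \<open>Harpoons are the \<open>Z\<close>-components of mixed products in
    \<open>E\<close>, triangles the \<open>V\<close>-components. The index selects the operation: 0
    and 1 the products in these degrees, 2 the left action, 3 the right action.\<close>
  define M where "M =
    \<lparr> rh0 = \<lambda>u x. D0.pr1 (g0 u \<cdot>\<^bsub>alg0 E\<^esub> f0 x), rh1 = \<lambda>u x. D1.pr1 (g1 u \<cdot>\<^bsub>alg1 E\<^esub> f1 x),
      rh2 = \<lambda>u x. D1.pr1 (lact E (g0 u) (f1 x)), rh3 = \<lambda>u x. D1.pr1 (ract E (g1 u) (f0 x)),
      lh0 = \<lambda>x u. D0.pr1 (f0 x \<cdot>\<^bsub>alg0 E\<^esub> g0 u), lh1 = \<lambda>x u. D1.pr1 (f1 x \<cdot>\<^bsub>alg1 E\<^esub> g1 u),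
      lh2 = \<lambda>x u. D1.pr1 (lact E (f0 x) (g1 u)), lh3 = \<lambda>x u. D1.pr1 (ract E (f1 x) (g0 u)),
      rt0 = \<lambda>x u. D0.pr2 (f0 x \<cdot>\<^bsub>alg0 E\<^esub> g0 u), rt1 = \<lambda>x u. D1.pr2 (f1 x \<cdot>\<^bsub>alg1 E\<^esub> g1 u),
      rt2 = \<lambda>x u. D1.pr2 (lact E (f0 x) (g1 u)), rt3 = \<lambda>x u. D1.pr2 (ract E (f1 x) (g0 u)),
      lt0 = \<lambda>u x. D0.pr2 (g0 u \<cdot>\<^bsub>alg0 E\<^esub> f0 x), lt1 = \<lambda>u x. D1.pr2 (g1 u \<cdot>\<^bsub>alg1 E\<^esub> f1 x),
      lt2 = \<lambda>u x. D1.pr2 (lact E (g0 u) (f1 x)), lt3 = \<lambda>u x. D1.pr2 (ract E (g1 u) (f0 x)) \<rparr>"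
  let ?B = "bicrossed_product Z V M"
  \<comment> \<open>Listed in the order of the indices 0 to 3 of the pair maps.\<close>
  note bilE = za_bil[OF z2_alg0[OF E]] za_bil[OF z2_alg1[OF E]] z2_lact_bil[OF E] z2_ract_bil[OF E]
  have bil: "pair_maps_bilinear Z V M"
    unfolding pair_maps_bilinear_def M_def pair_maps.simps
    by (intro conjI
      bilinear_map_comp[OF bilE(1) D0.lin_g D0.lin_f D0.pr1_linear]
      bilinear_map_comp[OF bilE(2) D1.lin_g D1.lin_f D1.pr1_linear]
      bilinear_map_comp[OF bilE(3) D0.lin_g D1.lin_f D1.pr1_linear]
      bilinear_map_comp[OF bilE(4) D1.lin_g D0.lin_f D1.pr1_linear]
      bilinear_map_comp[OF bilE(1) D0.lin_f D0.lin_g D0.pr1_linear]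
      bilinear_map_comp[OF bilE(2) D1.lin_f D1.lin_g D1.pr1_linear]
      bilinear_map_comp[OF bilE(3) D0.lin_f D1.lin_g D1.pr1_linear]
      bilinear_map_comp[OF bilE(4) D1.lin_f D0.lin_g D1.pr1_linear]
      bilinear_map_comp[OF bilE(1) D0.lin_f D0.lin_g D0.pr2_linear]
      bilinear_map_comp[OF bilE(2) D1.lin_f D1.lin_g D1.pr2_linear]
      bilinear_map_comp[OF bilE(3) D0.lin_f D1.lin_g D1.pr2_linear]
      bilinear_map_comp[OF bilE(4) D1.lin_f D0.lin_g D1.pr2_linear]
      bilinear_map_comp[OF bilE(1) D0.lin_g D0.lin_f D0.pr2_linear]
      bilinear_map_comp[OF bilE(2) D1.lin_g D1.lin_f D1.pr2_linear]
      bilinear_map_comp[OF bilE(3) D0.lin_g D1.lin_f D1.pr2_linear]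
      bilinear_map_comp[OF bilE(4) D1.lin_g D0.lin_f D1.pr2_linear])
  \<comment> \<open>Each operation is treated together with its closure, since the final pullback
    needs both. The degrees of the arguments and of the value determine which of \<open>D0\<close>
    and \<open>D1\<close> are supplied.\<close>
  have mul1: "?F1 (X \<cdot>\<^bsub>alg1 ?B\<^esub> Y) = ?F1 X \<cdot>\<^bsub>alg1 E\<^esub> ?F1 Y \<and> X \<cdot>\<^bsub>alg1 ?B\<^esub> Y \<in> carr (alg1 ?B)"
    if "X \<in> carr (alg1 ?B)" "Y \<in> carr (alg1 ?B)" for X Y
  proof -
    from that obtain x u y v where XY: "X = (x, u)" "Y = (y, v)"
      and m: "x \<in> carr (alg1 Z)" "y \<in> carr (alg1 Z)" "u \<in> carr (alg1 V)" "v \<in> carr (alg1 V)"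
      by auto
    show ?thesis
      using decomposition_bilinear_sum[OF D1 D1 D1 bilE(2) m z2_mul1[OF Z m(1,2)] emb_mul1[OF f m(1,2)]
          z2_mul1[OF V m(3,4)] emb_mul1[OF g m(3,4)]]
      by (simp add: M_def XY)
  qed
  have mul0: "?F0 (X \<cdot>\<^bsub>alg0 ?B\<^esub> Y) = ?F0 X \<cdot>\<^bsub>alg0 E\<^esub> ?F0 Y \<and> X \<cdot>\<^bsub>alg0 ?B\<^esub> Y \<in> carr (alg0 ?B)"
    if "X \<in> carr (alg0 ?B)" "Y \<in> carr (alg0 ?B)" for X Y
  proof -
    from that obtain x u y v where XY: "X = (x, u)" "Y = (y, v)"
      and m: "x \<in> carr (alg0 Z)" "y \<in> carr (alg0 Z)" "u \<in> carr (alg0 V)" "v \<in> carr (alg0 V)"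
      by auto
    show ?thesis
      using decomposition_bilinear_sum[OF D0 D0 D0 bilE(1) m z2_mul0[OF Z m(1,2)] emb_mul0[OF f m(1,2)]
          z2_mul0[OF V m(3,4)] emb_mul0[OF g m(3,4)]]
      by (simp add: M_def XY)
  qed
  have lact: "?F1 (lact ?B X Y) = lact E (?F0 X) (?F1 Y) \<and> lact ?B X Y \<in> carr (alg1 ?B)"
    if "X \<in> carr (alg0 ?B)" "Y \<in> carr (alg1 ?B)" for X Y
  proof -
    from that obtain x u y v where XY: "X = (x, u)" "Y = (y, v)"
      and m: "x \<in> carr (alg0 Z)" "y \<in> carr (alg1 Z)" "u \<in> carr (alg0 V)" "v \<in> carr (alg1 V)"
      by auto
    show ?thesis
      using decomposition_bilinear_sum[OF D0 D1 D1 bilE(3) m z2_lact[OF Z m(1,2)] emb_lact[OF f m(1,2)]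
          z2_lact[OF V m(3,4)] emb_lact[OF g m(3,4)]]
      by (simp add: M_def XY)
  qed
  have ract: "?F1 (ract ?B X Y) = ract E (?F1 X) (?F0 Y) \<and> ract ?B X Y \<in> carr (alg1 ?B)"
    if "X \<in> carr (alg1 ?B)" "Y \<in> carr (alg0 ?B)" for X Y
  proof -
    from that obtain x u y v where XY: "X = (x, u)" "Y = (y, v)"
      and m: "x \<in> carr (alg1 Z)" "y \<in> carr (alg0 Z)" "u \<in> carr (alg1 V)" "v \<in> carr (alg0 V)"
      by auto
    \<comment> \<open>\<open>emb_ract\<close> takes its degree 0 premise first, hence the swapped
      indices \<open>m(2,1)\<close> and \<open>m(4,3)\<close>.\<close>
    show ?thesis
      using decomposition_bilinear_sum[OF D1 D0 D1 bilE(4) m z2_ract[OF Z m(1,2)] emb_ract[OF f m(2,1)]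
          z2_ract[OF V m(3,4)] emb_ract[OF g m(4,3)]]
      by (simp add: M_def XY)
  qed
  have smap: "?F0 (smap ?B X) = smap E (?F1 X) \<and> smap ?B X \<in> carr (alg0 ?B)"
    if "X \<in> carr (alg1 ?B)" for X
    using that by (auto simp: z2_smap[OF Z] z2_smap[OF V] emb_smap[OF f] emb_smap[OF g]
        lin_add[OF z2_smap_lin[OF E]] lin_in[OF emb_lin1[OF f]] lin_in[OF emb_lin1[OF g]])
  have vs1: "vector_space_on (alg1 ?B)" and vs0: "vector_space_on (alg0 ?B)"
    by (rule vector_space_on_prod[OF z2_vs1[OF Z] z2_vs1[OF V]]
        vector_space_on_prod[OF z2_vs0[OF Z] z2_vs0[OF V]]; simp)+
  have lin: "linear_map (alg1 ?B) (alg1 E) ?F1" "linear_map (alg0 ?B) (alg0 E) ?F0"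
    by (rule linear_map_sum[OF z2_vs1[OF E] emb_lin1[OF f] emb_lin1[OF g]]
        linear_map_sum[OF z2_vs0[OF E] emb_lin0[OF f] emb_lin0[OF g]]; simp)+
  have iso: "zinbiel2_iso ?B E ?F1 ?F0"
    unfolding zinbiel2_iso_def zinbiel_hom_def
  proof (intro conjI ballI)
    show "bij_betw ?F1 (carr (alg1 ?B)) (carr (alg1 E))" "bij_betw ?F0 (carr (alg0 ?B)) (carr (alg0 E))"
      using bij1 bij0 by simp_all
  qed (simp_all only: lin mul1 mul0 lact ract smap)
  have emb: "zinbiel2_embedding ?B E ?F1 ?F0"
    using iso by (simp only: zinbiel2_iso_iff_embedding)
  \<comment> \<open>The sum maps preserve all operations and are injective, so the axioms of the
    bicrossed product hold because they hold in \<open>E\<close>.\<close>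
  have "zinbiel_2_algebra ?B"
    by (rule zinbiel_2_algebra_pullback[OF vs1 vs0 _ _ _ _ _ emb E])
      (simp_all only: mul1 mul0 lact ract smap)
  then show ?thesis using Z V bil iso by (auto simp: matched_pair_def)
qed

section \<open>From a matched pair to a decomposition\<close>

lemma pair_maps_bilinearD:
  assumes "pair_maps_bilinear Z V M"
  shows "bilinear_map (alg0 V) (alg0 Z) (alg0 Z) (rh0 M)"
    and "bilinear_map (alg1 V) (alg1 Z) (alg1 Z) (rh1 M)"
    and "bilinear_map (alg0 V) (alg1 Z) (alg1 Z) (rh2 M)"
    and "bilinear_map (alg1 V) (alg0 Z) (alg1 Z) (rh3 M)"
    and "bilinear_map (alg0 Z) (alg0 V) (alg0 Z) (lh0 M)"
    and "bilinear_map (alg1 Z) (alg1 V) (alg1 Z) (lh1 M)"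
    and "bilinear_map (alg0 Z) (alg1 V) (alg1 Z) (lh2 M)"
    and "bilinear_map (alg1 Z) (alg0 V) (alg1 Z) (lh3 M)"
    and "bilinear_map (alg0 Z) (alg0 V) (alg0 V) (rt0 M)"
    and "bilinear_map (alg1 Z) (alg1 V) (alg1 V) (rt1 M)"
    and "bilinear_map (alg0 Z) (alg1 V) (alg1 V) (rt2 M)"
    and "bilinear_map (alg1 Z) (alg0 V) (alg1 V) (rt3 M)"
    and "bilinear_map (alg0 V) (alg0 Z) (alg0 V) (lt0 M)"
    and "bilinear_map (alg1 V) (alg1 Z) (alg1 V) (lt1 M)"
    and "bilinear_map (alg0 V) (alg1 Z) (alg1 V) (lt2 M)"
    and "bilinear_map (alg1 V) (alg0 Z) (alg1 V) (lt3 M)"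
  using assms by (simp_all add: pair_maps_bilinear_def)

text \<open>When one component of both arguments is zero, bilinearity makes all mixed terms and the
  operation of the other factor vanish. What remains is the operation of the embedded
  factor.\<close>

lemma bicrossed_product_embeddings:
  assumes "matched_pair Z V M"
  shows "zinbiel2_embedding Z (bicrossed_product Z V M) (\<lambda>x. (x, 0)) (\<lambda>x. (x, 0))"
    and "zinbiel2_embedding V (bicrossed_product Z V M) (\<lambda>u. (0, u)) (\<lambda>u. (0, u))"
proof -
  have Z: "zinbiel_2_algebra Z" and V: "zinbiel_2_algebra V" and M: "pair_maps_bilinear Z V M"
    using assms by (auto simp: matched_pair_def)
  note vs = z2_vs1[OF Z] z2_vs0[OF Z] z2_vs1[OF V] z2_vs0[OF V]
  note bils = pair_maps_bilinearD[OF M]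
    za_bil[OF z2_alg1[OF Z]] za_bil[OF z2_alg0[OF Z]] z2_lact_bil[OF Z] z2_ract_bil[OF Z]
    za_bil[OF z2_alg1[OF V]] za_bil[OF z2_alg0[OF V]] z2_lact_bil[OF V] z2_ract_bil[OF V]
  note zeros = vs bils[THEN bil_zero_right] bils[THEN bil_zero_left] vs[THEN vs_zero]
    vs[THEN vs_module, THEN module.scale_zero_right]
    lin_zero[OF z2_smap_lin[OF Z] z2_vs1[OF Z]] lin_zero[OF z2_smap_lin[OF V] z2_vs1[OF V]]
  show "zinbiel2_embedding Z (bicrossed_product Z V M) (\<lambda>x. (x, 0)) (\<lambda>x. (x, 0))"
    by (simp add: zinbiel2_embedding_def zinbiel_hom_def linear_map_def inj_on_def zeros)
  show "zinbiel2_embedding V (bicrossed_product Z V M) (\<lambda>u. (0, u)) (\<lambda>u. (0, u))"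
    by (simp add: zinbiel2_embedding_def zinbiel_hom_def linear_map_def inj_on_def zeros)
qed

text \<open>A common element \<open>k (x, 0) = k (0, u)\<close> forces
  \<open>(x, 0) = (0, u)\<close> by injectivity, so it is \<open>k (0, 0)\<close>, which is zero.
  Both pairs lie in the domain because subspaces contain zero.\<close>

lemma direct_sum_of_bij:
  assumes vs: "vector_space_on A" "vector_space_on B"
    and inj: "inj_on k (carr A \<times> carr B)" and zero: "k (0, 0) = 0"
    and im: "k ` (carr A \<times> carr B) = carr E"
    and split: "\<And>x u. x \<in> carr A \<Longrightarrow> u \<in> carr B \<Longrightarrow> k (x, u) = k (x, 0) + k (0, u)"
    and A': "carr A' = (\<lambda>x. k (x, 0)) ` carr A" and B': "carr B' = (\<lambda>u. k (0, u)) ` carr B"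
  shows "direct_sum E A' B'"
  unfolding direct_sum_def
proof
  show "carr E = {x + u |x u. x \<in> carr A' \<and> u \<in> carr B'}"
    unfolding im[symmetric] A' B' using split by (fastforce simp: image_iff)
  have "k (x, 0) = 0" if "x \<in> carr A" "u \<in> carr B" "k (x, 0) = k (0, u)" for x u
  proof -
    have "(x, 0) = (0, u)"
      by (rule inj_onD[OF inj that(3)]) (use that vs_zero[OF vs(1)] vs_zero[OF vs(2)] in auto)
    then show ?thesis using zero by simp
  qed
  moreover have "0 \<in> carr A'" "0 \<in> carr B'"
    unfolding A' B' using zero vs_zero[OF vs(1)] vs_zero[OF vs(2)] by (metis imageI)+
  ultimately show "carr A' \<inter> carr B' = {0}"
    unfolding A' B' by blast
qed

text \<open>The required copies of \<open>Z\<close> and \<open>V\<close> are the images in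
  \<open>E\<close> of the two factors of the bicrossed product, carried over by the inverse
  \<open>k1\<close>, \<open>k0\<close> of the given isomorphism.\<close>

lemma factorizes_through_if_iso_bicrossed_product:
  assumes M: "matched_pair Z V M" and E: "zinbiel_2_algebra E"
    and iso: "E \<cong>\<^sub>Z bicrossed_product Z V M"
  shows "factorizes_through E Z V"
proof -
  let ?B = "bicrossed_product Z V M"
  have Z: "zinbiel_2_algebra Z" and V: "zinbiel_2_algebra V"
    using M by (auto simp: matched_pair_def)
  obtain k1 k0 where k: "zinbiel2_iso ?B E k1 k0"
    using iso zinbiel2_iso_inv_into[OF E] unfolding zinbiel2_isomorphic_def by blast
  have emb: "zinbiel2_embedding ?B E k1 k0"
    and im1: "k1 ` (carr (alg1 Z) \<times> carr (alg1 V)) = carr (alg1 E)"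
    and im0: "k0 ` (carr (alg0 Z) \<times> carr (alg0 V)) = carr (alg0 E)"
    using k by (simp_all add: zinbiel2_iso_iff_embedding)
  note embs = bicrossed_product_embeddings[OF M, THEN zinbiel2_embedding_comp[OF _ emb]]
  let ?Z = "image_algebra Z E (\<lambda>x. k1 (x, 0)) (\<lambda>x. k0 (x, 0))"
  let ?V = "image_algebra V E (\<lambda>u. k1 (0, u)) (\<lambda>u. k0 (0, u))"
  note subZ = image_algebra_subalgebra[OF Z E embs(1)]
  note subV = image_algebra_subalgebra[OF V E embs(2)]
  \<comment> \<open>Additivity applied to \<open>(x, u) = (x, 0) + (0, u)\<close>.\<close>
  have split1: "k1 (x, u) = k1 (x, 0) + k1 (0, u)" if "x \<in> carr (alg1 Z)" "u \<in> carr (alg1 V)" for x u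
    using lin_add[OF emb_lin1[OF emb], of "(x, 0)" "(0, u)"] that
      vs_zero[OF z2_vs1[OF Z]] vs_zero[OF z2_vs1[OF V]] by simp
  have split0: "k0 (x, u) = k0 (x, 0) + k0 (0, u)" if "x \<in> carr (alg0 Z)" "u \<in> carr (alg0 V)" for x u
    using lin_add[OF emb_lin0[OF emb], of "(x, 0)" "(0, u)"] that
      vs_zero[OF z2_vs0[OF Z]] vs_zero[OF z2_vs0[OF V]] by simp
  have "direct_sum (alg1 E) (alg1 ?Z) (alg1 ?V)"
    by (rule direct_sum_of_bij[OF z2_vs1[OF Z] z2_vs1[OF V] _ _ im1 split1])
      (use emb_inj1[OF emb] lin_zero[OF emb_lin1[OF embs(1)] z2_vs1[OF Z]] in simp_all)
  moreover have "direct_sum (alg0 E) (alg0 ?Z) (alg0 ?V)"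
    by (rule direct_sum_of_bij[OF z2_vs0[OF Z] z2_vs0[OF V] _ _ im0 split0])
      (use emb_inj0[OF emb] lin_zero[OF emb_lin0[OF embs(1)] z2_vs0[OF Z]] in simp_all)
  \<comment> \<open>Both image algebras carry the structure map of \<open>E\<close>, so this is its
    additivity.\<close>
  moreover have "smap E (x + u) = smap ?Z x + smap ?V u"
    if "x \<in> carr (alg1 ?Z)" "u \<in> carr (alg1 ?V)" for x u
    using that by (auto simp: lin_add[OF z2_smap_lin[OF E]]
        lin_in[OF emb_lin1[OF embs(1)]] lin_in[OF emb_lin1[OF embs(2)]])
  ultimately show ?thesis
    using subZ subV unfolding factorizes_through_def zinbiel2_isomorphic_def by blast
qed

theorem corollary3p6:
  fixes Z :: "('k::alg_closed_field, 'z1::ab_group_add, 'z0::ab_group_add) zinbiel2"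
    and V :: "('k, 'v1::ab_group_add, 'v0::ab_group_add) zinbiel2"
    and E :: "('k, 'e1::ab_group_add, 'e0::ab_group_add) zinbiel2"
  assumes "CHAR('k) \<noteq> 2" and "CHAR('k) \<noteq> 3"
    and "zinbiel_2_algebra Z" and "zinbiel_2_algebra V" and "zinbiel_2_algebra E"
  shows "factorizes_through E Z V \<longleftrightarrow>
           (\<exists>M. matched_pair Z V M \<and> E \<cong>\<^sub>Z bicrossed_product Z V M)"
proof
  assume "factorizes_through E Z V"
  then obtain Z' V' f1 f0 g1 g0
    where sub: "zinbiel2_subalgebra Z' E" "zinbiel2_subalgebra V' E"
      and f: "zinbiel2_iso Z Z' f1 f0" and g: "zinbiel2_iso V V' g1 g0"
      and sum: "direct_sum (alg1 E) (alg1 Z') (alg1 V')" "direct_sum (alg0 E) (alg0 Z') (alg0 V')"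
    unfolding factorizes_through_def zinbiel2_isomorphic_def by blast
  note embf = subalgebra_embedding[OF sub(1) f] and embg = subalgebra_embedding[OF sub(2) g]
  have im: "carr (alg1 Z') = f1 ` carr (alg1 Z)" "carr (alg0 Z') = f0 ` carr (alg0 Z)"
    "carr (alg1 V') = g1 ` carr (alg1 V)" "carr (alg0 V') = g0 ` carr (alg0 V)"
    using f g by (simp_all add: zinbiel2_iso_iff_embedding)
  \<comment> \<open>The direct sum conditions are restated for the images of \<open>f1\<close>,
    \<open>f0\<close>, \<open>g1\<close>, \<open>g0\<close>, the form in which
    \<open>bij_betw_direct_sum\<close> takes them.\<close>
  note sum' = sum[unfolded direct_sum_def im]
  obtain M where M: "matched_pair Z V M"
    and iso: "zinbiel2_iso (bicrossed_product Z V M) E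
      (\<lambda>(x, u). f1 x + g1 u) (\<lambda>(x, u). f0 x + g0 u)"
    using matched_pair_of_embeddings[OF assms(3-5) embf embg
        bij_betw_direct_sum[OF z2_vs1[OF assms(3)] z2_vs1[OF assms(4)]
          emb_lin1[OF embf] emb_inj1[OF embf] emb_lin1[OF embg] emb_inj1[OF embg]
          sum'(1)[THEN conjunct1] sum'(1)[THEN conjunct2]]
        bij_betw_direct_sum[OF z2_vs0[OF assms(3)] z2_vs0[OF assms(4)]
          emb_lin0[OF embf] emb_inj0[OF embf] emb_lin0[OF embg] emb_inj0[OF embg]
          sum'(2)[THEN conjunct1] sum'(2)[THEN conjunct2]]]
    by blast
  \<comment> \<open>The sum maps go from the bicrossed product to \<open>E\<close>; this fact allows
    them to be inverted to the required direction.\<close>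
  have "zinbiel_2_algebra (bicrossed_product Z V M)"
    using M by (simp add: matched_pair_def)
  from zinbiel2_iso_inv_into[OF this iso] M
  show "\<exists>M. matched_pair Z V M \<and> E \<cong>\<^sub>Z bicrossed_product Z V M"
    unfolding zinbiel2_isomorphic_def by blast
next
  assume "\<exists>M. matched_pair Z V M \<and> E \<cong>\<^sub>Z bicrossed_product Z V M"
  then show "factorizes_through E Z V"
    using factorizes_through_if_iso_bicrossed_product assms(5) by blast
qed

end
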